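(* For all $N,r\geq0$ and $f\in\mathrm{QSym}_N$, $$\Psi_{N+r,q}(h_rf;t)=Q_r\,\Psi_{N,q}(f;t).$$ The operators $Q_r$ commute pairwise.
   Context: $q$ is an indeterminate and identities are in $\mathbb Q(q)[[t]]$. $\mathrm{QSym}_N$ is the degree-$N$ homogeneous component of the ring of quasisymmetric functions over $\mathbb Q$ in commuting variables $z_1,z_2,\ldots$, and $h_r=\sum_{1\leq i_1\leq\cdots\leq i_r}z_{i_1}\cdots z_{i_r}$ ($h_0=1$) is the complete homogeneous symmetric function. For $f\in\mathrm{QSym}_N$, $$\Psi_{N,q}(f;t)=\sum_{k\geq0}f(q^k,q^{k-1},\ldots,q,1,0,0,\ldots)\,t^k,$$ i.e. in the $k$-th term $z_{i+1}=q^{k-i}$ for $0\leq i\leq k$ and $z_i=0$ for $i>k+1$. $\Theta_q$ is the $q$-shift $\Theta_qF(t)=F(qt)$ on $\mathbb Q(q)[[t]]$, and $$Q_r=\prod_{i=1}^{r}\frac{1-q^i\Theta_q}{1-q^i},\qquad Q_0=\mathrm{id}.$$ *)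

theory Defs
  imports
    "HOL-Library.Poly_Mapping"
    "HOL-Library.FuncSet"
    "HOL-Library.Multiset"
    "HOL-Computational_Algebra.Polynomial_Factorial"
    "HOL-Computational_Algebra.Formal_Power_Series"
begin

(* Formal power series over the rationals in commuting variables z_1, z_2, ..., given by their
   coefficient functions.  Indices start at 0: variable i is z_(i+1). *)

type_synonym monomial = "nat \<Rightarrow>\<^sub>0 nat"
type_synonym zseries = "monomial \<Rightarrow> rat"

definition mdeg :: "monomial \<Rightarrow> nat" where
  "mdeg m = (\<Sum>i\<in>Poly_Mapping.keys m. Poly_Mapping.lookup m i)"

definition z_times :: "zseries \<Rightarrow> zseries \<Rightarrow> zseries"  (infixl "\<star>" 70) where
  "f \<star> g = (\<lambda>m. \<Sum>(b, c)\<in>{(b, c). b + c = m}. f b * g c)"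

(* zmon l i a is the monomial z_(i 0 + 1)^(a 0) ... z_(i (l-1) + 1)^(a (l-1)) *)
definition zmon :: "nat \<Rightarrow> (nat \<Rightarrow> nat) \<Rightarrow> (nat \<Rightarrow> nat) \<Rightarrow> monomial" where
  "zmon l i a = (\<Sum>s<l. Poly_Mapping.single (i s) (a s))"

definition quasisymmetric :: "zseries \<Rightarrow> bool" where
  "quasisymmetric f \<longleftrightarrow>
    (\<forall>l a i j. (\<forall>s<l. a s > 0) \<longrightarrow> strict_mono_on {..<l} i \<longrightarrow> strict_mono_on {..<l} j \<longrightarrow>
       f (zmon l i a) = f (zmon l j a))"

definition QSym :: "zseries set" where
  "QSym = {f. quasisymmetric f \<and> (\<exists>d. \<forall>m. f m \<noteq> 0 \<longrightarrow> mdeg m \<le> d)}"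

definition QSym_hom :: "nat \<Rightarrow> zseries set" where
  "QSym_hom N = {f \<in> QSym. \<forall>m. f m \<noteq> 0 \<longrightarrow> mdeg m = N}"

(* The coefficient at m of the formal sum of z_(i_1) ... z_(i_r) over all
   i_1 <= ... <= i_r is the number of index sequences that produce m. *)
definition h :: "nat \<Rightarrow> zseries" where
  "h r = (\<lambda>m. of_nat (card {is. length is = r \<and> sorted is \<and>
                                (\<Sum>i\<leftarrow>is. Poly_Mapping.single i 1) = m}))"

type_synonym ratfun = "rat poly fract"

definition q :: ratfun where
  "q = to_fract [:0, 1:]"

(* Substitution z_(i+1) = x i.  Sum_any sums the nonzero terms; for a series of bounded degree and
   an x with finitely many nonzero values there are only finitely many of them. *)
definition z_eval :: "zseries \<Rightarrow> (nat \<Rightarrow> ratfun) \<Rightarrow> ratfun" where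
  "z_eval f x = Sum_any (\<lambda>m. to_fract [:f m:] *
                   (\<Prod>i\<in>Poly_Mapping.keys m. x i ^ Poly_Mapping.lookup m i))"

definition Psi :: "nat \<Rightarrow> zseries \<Rightarrow> ratfun fps" where
  "Psi N = (\<lambda>f\<in>QSym_hom N. Abs_fps (\<lambda>k. z_eval f (\<lambda>i. if i \<le> k then q ^ (k - i) else 0)))"

definition Theta :: "ratfun fps \<Rightarrow> ratfun fps" where
  "Theta F = F oo (fps_const q * fps_X)"

definition Q_factor :: "nat \<Rightarrow> ratfun fps \<Rightarrow> ratfun fps" where
  "Q_factor i F = fps_const (inverse (1 - q ^ i)) * (F - fps_const (q ^ i) * Theta F)"

primrec Q_op :: "nat \<Rightarrow> ratfun fps \<Rightarrow> ratfun fps" where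
  "Q_op 0 = id"
| "Q_op (Suc r) = Q_factor (Suc r) \<circ> Q_op r"


lemma q_power_neq_1: "i > 0 \<Longrightarrow> q ^ i \<noteq> 1"
proof
  assume i: "i > 0" and e: "q ^ i = 1"
  have p: "to_fract p ^ n = to_fract (p ^ n)" for p :: "rat poly" and n
    by (induction n) auto
  have "to_fract ([:0, 1::rat:] ^ i) = to_fract 1"
    using e by (simp add: q_def p)
  hence "[:0, 1::rat:] ^ i = 1" by (simp only: to_fract_eq_iff)
  hence "poly ([:0, 1::rat:] ^ i) 0 = poly 1 0" by simp
  thus False using i by (simp add: zero_power)
qed

lemma Theta_nth: "fps_nth (Theta F) n = q ^ n * fps_nth F n"
  by (simp add: Theta_def fps_compose_linear)

lemma finite_add_decomp: "finite {(b, c). b + c = (m :: monomial)}"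
proof -
  let ?K = "{b. \<forall>i. Poly_Mapping.lookup b i \<le> Poly_Mapping.lookup m i}"
  let ?A = "Poly_Mapping.keys m" and ?B = "{..Max (insert 0 (Poly_Mapping.lookup m ` Poly_Mapping.keys m))}"
  have "Poly_Mapping.lookup ` ?K \<subseteq> {f. \<forall>x. (x \<in> ?A \<longrightarrow> f x \<in> ?B) \<and> (x \<notin> ?A \<longrightarrow> f x = 0)}"
  proof (rule image_subsetI, rule CollectI, intro allI conjI impI)
    fix b x assume "b \<in> ?K"
    hence b: "Poly_Mapping.lookup b x \<le> Poly_Mapping.lookup m x" by simp
    show "Poly_Mapping.lookup b x \<in> ?B" if "x \<in> ?A"
      unfolding atMost_iff using that by (intro order.trans[OF b] Max_ge) auto
    show "Poly_Mapping.lookup b x = 0" if "x \<notin> ?A"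
      using b that by (simp add: in_keys_iff)
  qed
  hence "finite (Poly_Mapping.lookup ` ?K)"
    by (rule finite_subset) (intro finite_set_of_finite_funs; simp)
  hence "finite ?K"
    by (rule finite_imageD) (simp add: inj_on_def)
  hence "finite (?K \<times> ?K)" by blast
  moreover have "{(b, c). b + c = m} \<subseteq> ?K \<times> ?K"
    by (auto simp: lookup_add)
  ultimately show ?thesis by (rule rev_finite_subset)
qed

lemma mdeg_superset:
  assumes "finite A" "Poly_Mapping.keys m \<subseteq> A"
  shows "mdeg m = (\<Sum>i\<in>A. Poly_Mapping.lookup m i)"
  unfolding mdeg_def using assms
  by (intro sum.mono_neutral_left) (auto simp: in_keys_iff)

lemma mdeg_0 [simp]: "mdeg 0 = 0"
  by (simp add: mdeg_def)

lemma mdeg_single [simp]: "mdeg (Poly_Mapping.single i a) = a"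
  by (simp add: mdeg_def)

lemma mdeg_add: "mdeg (b + c) = mdeg b + mdeg c"
proof -
  let ?A = "Poly_Mapping.keys b \<union> Poly_Mapping.keys c"
  have "Poly_Mapping.keys (b + c) \<subseteq> ?A" by (rule keys_add)
  thus ?thesis
    by (simp add: mdeg_superset[of ?A] lookup_add sum.distrib)
qed

lemma lookup_sum_list_single:
  "Poly_Mapping.lookup (\<Sum>i\<leftarrow>is. Poly_Mapping.single i 1) x = count (mset is) x"
  by (induction "is") (auto simp: lookup_add lookup_single)

lemma mdeg_zmon: "mdeg (zmon l i a) = (\<Sum>s<l. a s)"
  unfolding zmon_def by (induction l) (auto simp: mdeg_add)

lemma h_eq: "h r m = (if mdeg m = r then 1 else 0)"
proof -
  define X where "X = Abs_multiset (Poly_Mapping.lookup m)"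
  have cX: "count X = Poly_Mapping.lookup m"
  proof -
    have "finite {x. Poly_Mapping.lookup m x > 0}"
      using finite_lookup[of m] by simp
    thus ?thesis by (simp add: X_def)
  qed
  have sX: "size X = mdeg m"
    by (simp add: size_multiset_overloaded_eq mdeg_def cX)
       (rule sum.cong; auto simp: cX in_keys_iff set_mset_def)
  have eq: "(\<Sum>i\<leftarrow>is. Poly_Mapping.single i 1) = m \<longleftrightarrow> mset is = X" for "is"
    by (auto simp: poly_mapping_eq_iff multiset_eq_iff fun_eq_iff lookup_sum_list_single cX simp del: One_nat_def)
  have "{is. length is = r \<and> sorted is \<and> (\<Sum>i\<leftarrow>is. Poly_Mapping.single i 1) = m} =
        (if mdeg m = r then {sorted_list_of_multiset X} else {})"
    unfolding eq
    by (auto simp: sX[symmetric] simp flip: size_mset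
             intro: properties_for_sort[symmetric])
  thus ?thesis by (simp add: h_def)
qed

lemma quasisymmetric_zmon:
  assumes f: "quasisymmetric f"
    and i: "strict_mono_on {..<l} i" and j: "strict_mono_on {..<l} j"
  shows "f (zmon l i a) = f (zmon l j a)"
proof -
  define S where "S = {s. s < l \<and> a s > 0}"
  have fS: "finite S" by (simp add: S_def)
  define L where "L = sorted_list_of_set S"
  define e where "e = (\<lambda>n. L ! n)"
  have L: "set L = S" "sorted_wrt (<) L" "distinct L" "length L = card S"
    using fS by (auto simp: L_def sorted_list_of_set.strict_sorted_key_list_of_set)
  have e: "strict_mono_on {..<card S} e"
    unfolding e_def
    by (rule strict_mono_onI) (simp add: L sorted_wrt_nth_less)
  have bij: "bij_betw e {..<card S} S"
    unfolding e_def by (rule bij_betw_nth) (simp_all add: L)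
  have eS: "e n < l" "a (e n) > 0" if "n < card S" for n
  proof -
    have "e n \<in> S"
      using bij_betwE[OF bij] that by blast
    thus "e n < l" "a (e n) > 0"
      unfolding S_def by simp_all
  qed
  have *: "zmon l p a = zmon (card S) (p \<circ> e) (a \<circ> e)" for p
  proof -
    have "zmon l p a = (\<Sum>s\<in>S. Poly_Mapping.single (p s) (a s))"
      unfolding zmon_def by (intro sum.mono_neutral_right) (auto simp: S_def)
    also have "\<dots> = zmon (card S) (p \<circ> e) (a \<circ> e)"
      unfolding zmon_def o_def by (rule sum.reindex_bij_betw[OF bij, symmetric])
    finally show ?thesis .
  qed
  have m: "strict_mono_on {..<card S} (p \<circ> e)" if "strict_mono_on {..<l} p" for p :: "nat \<Rightarrow> nat"
  proof (rule strict_mono_onI)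
    fix r s assume rs: "r \<in> {..<card S}" "s \<in> {..<card S}" "r < s"
    show "(p \<circ> e) r < (p \<circ> e) s"
      unfolding o_def using rs eS(1)
      by (intro strict_mono_onD[OF that] strict_mono_onD[OF e]) simp_all
  qed
  have "\<forall>n<card S. (a \<circ> e) n > 0"
    using eS(2) by simp
  hence "f (zmon (card S) (i \<circ> e) (a \<circ> e)) = f (zmon (card S) (j \<circ> e) (a \<circ> e))"
    using f m[OF i] m[OF j] unfolding quasisymmetric_def by blast
  thus ?thesis
    by (simp only: *[of i] *[of j])
qed

lemma lookup_zmon:
  assumes "inj_on i {..<l}"
  shows "s < l \<Longrightarrow> Poly_Mapping.lookup (zmon l i a) (i s) = a s"
    and "x \<notin> i ` {..<l} \<Longrightarrow> Poly_Mapping.lookup (zmon l i a) x = 0"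
proof -
  assume s: "s < l"
  have "Poly_Mapping.lookup (zmon l i a) (i s) = (\<Sum>t<l. if t = s then a s else 0)"
    unfolding zmon_def lookup_sum using assms s
    by (intro sum.cong) (auto simp: lookup_single when_def inj_on_def)
  thus "Poly_Mapping.lookup (zmon l i a) (i s) = a s" using s by simp
next
  assume "x \<notin> i ` {..<l}"
  thus "Poly_Mapping.lookup (zmon l i a) x = 0"
    unfolding zmon_def lookup_sum by (auto simp: lookup_single when_def)
qed

lemma z_times_zmon:
  assumes "inj_on i {..<l}"
  shows "(f \<star> g) (zmon l i a) =
    (\<Sum>\<beta>\<in>PiE {..<l} (\<lambda>s. {..a s}). f (zmon l i \<beta>) * g (zmon l i (\<lambda>s. a s - \<beta> s)))"
proof -
  let ?P = "PiE {..<l} (\<lambda>s. {..a s})"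
  let ?\<phi> = "\<lambda>\<beta>. (zmon l i \<beta>, zmon l i (\<lambda>s. a s - \<beta> s))"
  note lk = lookup_zmon[OF assms]
  have "bij_betw ?\<phi> ?P {(b, c). b + c = zmon l i a}"
    unfolding bij_betw_def
  proof (intro conjI equalityI subsetI)
    show "inj_on ?\<phi> ?P"
    proof (rule inj_onI)
      fix \<beta> \<gamma> assume m: "\<beta> \<in> ?P" "\<gamma> \<in> ?P" and e: "?\<phi> \<beta> = ?\<phi> \<gamma>"
      have "\<beta> s = \<gamma> s" if "s < l" for s
        using e lk(1)[OF that, of \<beta>] lk(1)[OF that, of \<gamma>] by simp
      thus "\<beta> = \<gamma>" using m by (intro PiE_ext[of \<beta> _ _ \<gamma>]) auto
    qed
  next
    fix p assume "p \<in> ?\<phi> ` ?P"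
    then obtain \<beta> where b: "\<beta> \<in> ?P" "p = ?\<phi> \<beta>" by auto
    have "zmon l i \<beta> + zmon l i (\<lambda>s. a s - \<beta> s) = zmon l i a"
      unfolding zmon_def sum.distrib[symmetric] single_add[symmetric]
      using b(1) by (intro sum.cong refl) (auto simp: PiE_iff)
    thus "p \<in> {(b, c). b + c = zmon l i a}" using b by simp
  next
    fix p assume "p \<in> {(b, c). b + c = zmon l i a}"
    then obtain b c where p: "p = (b, c)" and bc: "b + c = zmon l i a" by auto
    define \<beta> where "\<beta> = restrict (\<lambda>s. Poly_Mapping.lookup b (i s)) {..<l}"
    have s: "Poly_Mapping.lookup b (i s) + Poly_Mapping.lookup c (i s) = a s" if "s < l" for s
      using lk(1)[OF that, of a] bc by (metis lookup_add)
    have z: "Poly_Mapping.lookup b x = 0" "Poly_Mapping.lookup c x = 0" if "x \<notin> i ` {..<l}" for x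
      using lk(2)[OF that, of a] bc by (metis lookup_add add_is_0)+
    have "\<beta> \<in> ?P" unfolding \<beta>_def by (intro restrict_PiE_iff[THEN iffD2] ballI) (simp flip: s)
    moreover have "zmon l i \<beta> = b"
    proof (rule poly_mapping_eqI)
      fix x show "Poly_Mapping.lookup (zmon l i \<beta>) x = Poly_Mapping.lookup b x"
        by (cases "x \<in> i ` {..<l}") (auto simp: lk z \<beta>_def)
    qed
    moreover have "zmon l i (\<lambda>s. a s - \<beta> s) = c"
    proof (rule poly_mapping_eqI)
      fix x show "Poly_Mapping.lookup (zmon l i (\<lambda>s. a s - \<beta> s)) x = Poly_Mapping.lookup c x"
        by (cases "x \<in> i ` {..<l}") (auto simp: lk z \<beta>_def simp flip: s)
    qed
    ultimately show "p \<in> ?\<phi> ` ?P" using p by (auto intro!: image_eqI[of _ _ \<beta>])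
  qed
  from sum.reindex_bij_betw[OF this, of "\<lambda>(b, c). f b * g c"]
  show ?thesis by (simp add: z_times_def)
qed

lemma quasisymmetric_z_times:
  assumes "quasisymmetric f" "quasisymmetric g"
  shows "quasisymmetric (f \<star> g)"
  unfolding quasisymmetric_def
proof (intro allI impI)
  fix l and a i j :: "nat \<Rightarrow> nat"
  assume i: "strict_mono_on {..<l} i" and j: "strict_mono_on {..<l} j"
  show "(f \<star> g) (zmon l i a) = (f \<star> g) (zmon l j a)"
    unfolding z_times_zmon[OF strict_mono_on_imp_inj_on[OF i]]
      z_times_zmon[OF strict_mono_on_imp_inj_on[OF j]]
    using quasisymmetric_zmon[OF assms(1) i j] quasisymmetric_zmon[OF assms(2) i j] by simp
qed

lemma QSym_homI:
  "quasisymmetric f \<Longrightarrow> (\<And>m. f m \<noteq> 0 \<Longrightarrow> mdeg m = N) \<Longrightarrow> f \<in> QSym_hom N"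
  by (auto simp: QSym_hom_def QSym_def)

lemma h_in_QSym_hom: "h r \<in> QSym_hom r"
  by (rule QSym_homI) (auto simp: quasisymmetric_def h_eq mdeg_zmon split: if_splits)

lemma z_times_in_QSym_hom:
  assumes "f \<in> QSym_hom M" "g \<in> QSym_hom N"
  shows "f \<star> g \<in> QSym_hom (M + N)"
proof (rule QSym_homI)
  show "quasisymmetric (f \<star> g)"
    using assms by (auto simp: QSym_hom_def QSym_def intro: quasisymmetric_z_times)
next
  fix m assume "(f \<star> g) m \<noteq> 0"
  then obtain b c where "b + c = m" "f b * g c \<noteq> 0"
    unfolding z_times_def by (auto elim!: sum.not_neutral_contains_not_neutral)
  thus "mdeg m = M + N"
    using assms by (auto simp: QSym_hom_def mdeg_add)
qed

lemma h_times_in_QSym_hom: "f \<in> QSym_hom N \<Longrightarrow> h r \<star> f \<in> QSym_hom (N + r)"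
  using z_times_in_QSym_hom[OF h_in_QSym_hom, of f N r] by (simp add: add.commute)

lemma finite_z_eval_support:
  assumes f: "f \<in> QSym" and x: "finite {i. x i \<noteq> 0}"
  shows "finite {m. to_fract [:f m:] *
           (\<Prod>i\<in>Poly_Mapping.keys m. (x i :: ratfun) ^ Poly_Mapping.lookup m i) \<noteq> 0}"
    (is "finite ?S")
proof -
  obtain d where d: "\<And>m. f m \<noteq> 0 \<Longrightarrow> mdeg m \<le> d" using f by (auto simp: QSym_def)
  let ?A = "{i. x i \<noteq> 0}"
  have "Poly_Mapping.lookup ` ?S \<subseteq> {g. \<forall>y. (y \<in> ?A \<longrightarrow> g y \<in> {..d}) \<and> (y \<notin> ?A \<longrightarrow> g y = 0)}"
  proof (rule image_subsetI)
    fix m assume "m \<in> ?S"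
    hence fm: "f m \<noteq> 0" and n: "\<And>i. i \<in> Poly_Mapping.keys m \<Longrightarrow> x i \<noteq> 0"
      by (auto simp: in_keys_iff)
    have "Poly_Mapping.lookup m y \<le> mdeg m" for y
      unfolding mdeg_def
      by (cases "y \<in> Poly_Mapping.keys m") (simp_all add: member_le_sum not_in_keys_iff_lookup_eq_zero)
    hence "Poly_Mapping.lookup m y \<le> d" for y using d[OF fm] le_trans by blast
    thus "Poly_Mapping.lookup m \<in> {g. \<forall>y. (y \<in> ?A \<longrightarrow> g y \<in> {..d}) \<and> (y \<notin> ?A \<longrightarrow> g y = 0)}"
      using n by (auto simp: in_keys_iff)
  qed
  hence "finite (Poly_Mapping.lookup ` ?S)"
    by (rule finite_subset) (intro finite_set_of_finite_funs x; simp)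
  thus ?thesis
    by (rule finite_imageD) (simp add: inj_on_def)
qed

end

theory Submission
  imports Defs
begin

text \<open>
  The \<open>k\<close>-th coefficient of \<open>\<Psi>(h\<^sub>r f)\<close> is the product of the evaluations of \<open>h\<^sub>r\<close> and \<open>f\<close> at
  \<open>(q\<^sup>k, \<dots>, q, 1, 0, \<dots>)\<close>, and \<open>h\<^sub>r(q\<^sup>k, \<dots>, q, 1)\<close> is the Gaussian binomial
  \<open>\<Prod>i=1..r. (1 - q\<^bsup>k+i\<^esup>) / (1 - q\<^sup>i)\<close>.  This is the eigenvalue of \<open>Q\<^sub>r\<close> on \<open>t\<^sup>k\<close>: all
  the \<open>Q\<^sub>r\<close> are diagonal in the monomial basis, hence commute.
\<close>

section \<open>Multiplicativity of evaluation at points with finitely many nonzero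
  coordinates\<close>

definition monomial_eval :: "(nat \<Rightarrow> ratfun) \<Rightarrow> monomial \<Rightarrow> ratfun" where
  "monomial_eval x m = (\<Prod>i\<in>Poly_Mapping.keys m. x i ^ Poly_Mapping.lookup m i)"

lemma monomial_eval_superset:
  assumes "finite A" "Poly_Mapping.keys m \<subseteq> A"
  shows "monomial_eval x m = (\<Prod>i\<in>A. x i ^ Poly_Mapping.lookup m i)"
  unfolding monomial_eval_def using assms
  by (intro prod.mono_neutral_left) (auto simp: in_keys_iff)

lemma monomial_eval_0 [simp]: "monomial_eval x 0 = 1"
  by (simp add: monomial_eval_def)

lemma monomial_eval_single [simp]: "monomial_eval x (Poly_Mapping.single i a) = x i ^ a"
  by (simp add: monomial_eval_def)

lemma monomial_eval_add: "monomial_eval x (b + c) = monomial_eval x b * monomial_eval x c"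
proof -
  let ?A = "Poly_Mapping.keys b \<union> Poly_Mapping.keys c"
  have "Poly_Mapping.keys (b + c) \<subseteq> ?A" by (rule keys_add)
  thus ?thesis
    by (simp add: monomial_eval_superset[of ?A] lookup_add power_add prod.distrib)
qed

lemma z_eval_eq_sum:
  assumes "finite A" "\<And>m. m \<notin> A \<Longrightarrow> to_fract [:f m:] * monomial_eval x m = 0"
  shows "z_eval f x = (\<Sum>m\<in>A. to_fract [:f m:] * monomial_eval x m)"
  unfolding z_eval_def monomial_eval_def[symmetric]
  by (rule Sum_any.expand_superset) (use assms in auto)

lemma to_fract_const_sum: "to_fract [:sum g A:] = (\<Sum>a\<in>A. to_fract [:g a :: rat:])"
proof (induction A rule: infinite_finite_induct)
  case (insert a A)
  have "[:g a + sum g A:] = [:g a:] + [:sum g A:]" by simp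
  with insert.IH show ?case by (simp only: sum.insert[OF insert.hyps] to_fract_add)
qed simp_all

text \<open>Bounded degree and finitely many nonzero \<open>x i\<close> leave finitely many nonzero
  terms in each factor, so the product of the two values is a finite double sum that can be
  regrouped by the monomial \<open>b + c\<close>.\<close>

lemma z_eval_z_times:
  assumes f: "f \<in> QSym" and g: "g \<in> QSym" and x: "finite {i. x i \<noteq> 0}"
  shows "z_eval (f \<star> g) x = z_eval f x * z_eval g x"
proof -
  define F where "F = (\<lambda>m. to_fract [:f m:] * monomial_eval x m)"
  define G where "G = (\<lambda>m. to_fract [:g m:] * monomial_eval x m)"
  define B where "B = {m. F m \<noteq> 0}"
  define C where "C = {m. G m \<noteq> 0}"
  have finB: "finite B" and finC: "finite C"
    using finite_z_eval_support[OF f x] finite_z_eval_support[OF g x]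
    by (simp_all add: B_def C_def F_def G_def monomial_eval_def)
  define M where "M = (\<lambda>(b, c). b + c) ` (B \<times> C)"
  \<comment> \<open>Decompositions of \<open>m\<close> outside \<open>B \<times> C\<close>
    contribute 0, so only the fibre of addition over \<open>m\<close> inside this finite set
    remains; \<open>sum.image_gen\<close> later sums over these fibres.\<close>
  have coeff: "to_fract [:(f \<star> g) m:] * monomial_eval x m =
      (\<Sum>(b, c)\<in>{p \<in> B \<times> C. (case p of (b, c) \<Rightarrow> b + c) = m}. F b * G c)" for m
  proof -
    have "to_fract [:(f \<star> g) m:] * monomial_eval x m =
        (\<Sum>p\<in>{(b, c). b + c = m}. to_fract [:f (fst p) * g (snd p):] * monomial_eval x m)"
      by (simp add: z_times_def to_fract_const_sum sum_distrib_right case_prod_unfold)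
    also have "\<dots> = (\<Sum>(b, c)\<in>{(b, c). b + c = m}. F b * G c)"
    proof (rule sum.cong)
      fix p assume "p \<in> {(b, c). b + c = m}"
      moreover have "to_fract [:f b * g c:] = to_fract [:f b:] * to_fract [:g c:]" for b c
        by (simp flip: to_fract_mult)
      ultimately show "to_fract [:f (fst p) * g (snd p):] * monomial_eval x m =
          (case p of (b, c) \<Rightarrow> F b * G c)"
        by (auto simp: F_def G_def monomial_eval_add)
    qed simp
    also have "\<dots> = (\<Sum>(b, c)\<in>{p \<in> B \<times> C. (case p of (b, c) \<Rightarrow> b + c) = m}. F b * G c)"
      by (rule sum.mono_neutral_right[OF finite_add_decomp]) (auto simp: B_def C_def)
    finally show ?thesis .
  qed
  have finM: "finite M" using finB finC by (simp add: M_def)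
  have "z_eval (f \<star> g) x = (\<Sum>m\<in>M. to_fract [:(f \<star> g) m:] * monomial_eval x m)"
  proof (rule z_eval_eq_sum[OF finM])
    fix m assume "m \<notin> M"
    hence "{p \<in> B \<times> C. (case p of (b, c) \<Rightarrow> b + c) = m} = {}"
      by (auto simp: M_def)
    thus "to_fract [:(f \<star> g) m:] * monomial_eval x m = 0"
      unfolding coeff by (simp only: sum.empty)
  qed
  also have "\<dots> = (\<Sum>(b, c)\<in>B \<times> C. F b * G c)"
    unfolding coeff M_def by (rule sum.image_gen[symmetric]) (simp add: finB finC)
  also have "\<dots> = (\<Sum>m\<in>B. F m) * (\<Sum>m\<in>C. G m)"
    by (simp add: sum_product sum.cartesian_product)
  also have "(\<Sum>m\<in>B. F m) = z_eval f x"
    unfolding F_def by (rule z_eval_eq_sum[symmetric, OF finB]) (simp add: B_def F_def)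
  also have "(\<Sum>m\<in>C. G m) = z_eval g x"
    unfolding G_def by (rule z_eval_eq_sum[symmetric, OF finC]) (simp add: C_def G_def)
  finally show ?thesis .
qed

section \<open>Complete homogeneous polynomials in finitely many variables\<close>

definition monomials :: "nat \<Rightarrow> nat \<Rightarrow> monomial set" where
  "monomials r n = {m. Poly_Mapping.keys m \<subseteq> {..<n} \<and> mdeg m = r}"

lemma monomials_0: "monomials 0 n = {0}"
proof -
  have "m = 0" if "mdeg m = 0" for m
    using that by (simp add: mdeg_def in_keys_iff flip: keys_eq_empty) (metis all_not_in_conv in_keys_iff)
  thus ?thesis by (auto simp: monomials_def)
qed

lemma monomials_Suc_0: "monomials (Suc r) 0 = {}"
  by (auto simp: monomials_def)

text \<open>Split by whether the last variable, of index \<open>n\<close>, occurs; if it does, one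
  factor of it can be divided out.\<close>

lemma monomials_Suc_Suc:
  "monomials (Suc r) (Suc n) =
     monomials (Suc r) n \<union> (\<lambda>m. m + Poly_Mapping.single n 1) ` monomials r (Suc n)"
proof (intro equalityI subsetI)
  fix m assume m: "m \<in> monomials (Suc r) (Suc n)"
  show "m \<in> monomials (Suc r) n \<union> (\<lambda>m. m + Poly_Mapping.single n 1) ` monomials r (Suc n)"
  proof (cases "n \<in> Poly_Mapping.keys m")
    case False
    hence "Poly_Mapping.keys m \<subseteq> {..<n}"
      using m by (auto simp: monomials_def lessThan_Suc)
    with m show ?thesis by (simp add: monomials_def)
  next
    case True
    \<comment> \<open>Subtraction of exponents truncates at 0, but here the exponent at
      \<open>n\<close> is positive, so nothing is lost.\<close>
    define b where "b = m - Poly_Mapping.single n 1"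
    have mb: "m = b + Poly_Mapping.single n 1"
      using True
      by (intro poly_mapping_eqI) (auto simp: b_def lookup_add lookup_minus lookup_single when_def in_keys_iff)
    have "Poly_Mapping.keys b \<subseteq> Poly_Mapping.keys m"
      by (auto simp: b_def in_keys_iff lookup_minus)
    moreover have "mdeg m = Suc (mdeg b)"
      by (subst mb) (simp add: mdeg_add)
    ultimately have "b \<in> monomials r (Suc n)"
      using m by (auto simp: monomials_def)
    thus ?thesis using mb by blast
  qed
next
  fix m assume "m \<in> monomials (Suc r) n \<union> (\<lambda>m. m + Poly_Mapping.single n 1) ` monomials r (Suc n)"
  thus "m \<in> monomials (Suc r) (Suc n)"
  proof
    assume "m \<in> (\<lambda>m. m + Poly_Mapping.single n 1) ` monomials r (Suc n)"
    then obtain b where b: "b \<in> monomials r (Suc n)" "m = b + Poly_Mapping.single n 1" by blast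
    moreover have "Poly_Mapping.keys m \<subseteq> Poly_Mapping.keys b \<union> {n}"
      unfolding b(2) using keys_add[of b "Poly_Mapping.single n 1"] by simp
    ultimately show ?thesis by (auto simp: monomials_def mdeg_add)
  qed (auto simp: monomials_def)
qed

lemma finite_monomials: "finite (monomials r n)"
proof (induction r arbitrary: n)
  case (Suc r)
  show ?case by (induction n) (simp_all add: monomials_Suc_0 monomials_Suc_Suc Suc)
qed (simp add: monomials_0)

lemma sum_monomials_Suc_Suc:
  "(\<Sum>m\<in>monomials (Suc r) (Suc n). monomial_eval x m) =
     (\<Sum>m\<in>monomials (Suc r) n. monomial_eval x m) + x n * (\<Sum>m\<in>monomials r (Suc n). monomial_eval x m)"
proof -
  have "n \<in> Poly_Mapping.keys (m + Poly_Mapping.single n 1)" for m :: monomial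
    by (simp add: in_keys_iff lookup_add)
  hence disj: "monomials (Suc r) n \<inter> (\<lambda>m. m + Poly_Mapping.single n 1) ` monomials r (Suc n) = {}"
    by (fastforce simp: monomials_def)
  have inj: "inj_on (\<lambda>m. m + Poly_Mapping.single n 1) (monomials r (Suc n))"
    by (simp add: inj_on_def)
  show ?thesis
    unfolding monomials_Suc_Suc
    by (subst sum.union_disjoint)
       (use disj in \<open>simp_all add: finite_monomials sum.reindex[OF inj] monomial_eval_add
          sum_distrib_left mult.commute del: One_nat_def\<close>)
qed

text \<open>The factor \<open>q\<^bsup>r(k + 1 - n)\<^esup>\<close> lets the induction run over the first \<open>n\<close> variables.\<close>

lemma sum_monomials_q_powers:
  assumes "n \<le> Suc k" "\<And>i. i \<le> k \<Longrightarrow> x i = q ^ (k - i)"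
  shows "(\<Sum>m\<in>monomials r n. monomial_eval x m) =
     q ^ ((Suc k - n) * r) * (\<Prod>i<r. (1 - q ^ (n + i)) / (1 - q ^ Suc i))"
  using assms(1)
proof (induction r arbitrary: n)
  case 0
  show ?case by (simp add: monomials_0)
next
  case (Suc r)
  \<comment> \<open>The recurrence leads from (r+1, n+1) to (r+1, n) and (r, n+1): the first is
    covered by an inner induction on \<open>n\<close>, the second by this outer hypothesis, which
    holds for every \<open>n\<close>.\<close>
  note r_IH = Suc.IH
  from Suc.prems show ?case
  proof (induction n)
    case 0
    \<comment> \<open>There are no monomials, and the product vanishes by its factor at i = 0, whose
      numerator is 1 - q^0.\<close>
    show ?case by (simp add: monomials_Suc_0 prod.lessThan_Suc_shift del: prod.lessThan_Suc)
  next
    case (Suc n)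
    define d where "d = k - n"
    have d: "Suc k - n = Suc d" "Suc k - Suc n = d" "x n = q ^ d"
      using Suc.prems assms(2)[of n] by (simp_all add: d_def)
    define P where "P = (\<Prod>i<r. (1 - q ^ (Suc n + i)) / (1 - q ^ Suc i))"
    have nz: "1 - q ^ Suc r \<noteq> 0"
      using q_power_neq_1[of "Suc r"] by simp
    \<comment> \<open>Both products of length r+1 contain the numerators of \<open>P\<close>; the
      extra one is 1 - q^n at the lower end here and 1 - q^(n+1+r) at the upper end in
      \<open>ext\<close>.\<close>
    have shift: "(\<Prod>i<Suc r. (1 - q ^ (n + i)) / (1 - q ^ Suc i)) = (1 - q ^ n) / (1 - q ^ Suc r) * P"
      unfolding P_def prod_dividef
      by (subst prod.lessThan_Suc_shift, subst prod.lessThan_Suc) simp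
    have ext: "(\<Prod>i<Suc r. (1 - q ^ (Suc n + i)) / (1 - q ^ Suc i)) =
        (1 - q ^ (Suc n + r)) / (1 - q ^ Suc r) * P"
      unfolding P_def by (simp add: mult.commute)
    have "(\<Sum>m\<in>monomials (Suc r) (Suc n). monomial_eval x m) =
        q ^ (Suc d * Suc r) * ((1 - q ^ n) / (1 - q ^ Suc r) * P) + q ^ d * (q ^ (d * r) * P)"
      using Suc.IH Suc.prems r_IH[OF Suc.prems]
      unfolding sum_monomials_Suc_Suc shift d P_def by simp
    also have "\<dots> = q ^ (d * Suc r) * ((q ^ Suc r * (1 - q ^ n) / (1 - q ^ Suc r) + 1) * P)"
      by (simp add: power_add algebra_simps)
    \<comment> \<open>The q-Pascal rule: q^(r+1) (1 - q^n) + (1 - q^(r+1)) = 1 - q^(n+r+1).\<close>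
    also have "q ^ Suc r * (1 - q ^ n) / (1 - q ^ Suc r) + 1 = (1 - q ^ (Suc n + r)) / (1 - q ^ Suc r)"
      using nz by (simp add: field_simps power_add)
    finally show ?case unfolding ext d .
  qed
qed

lemma z_eval_h_q_powers:
  "z_eval (h r) (\<lambda>i. if i \<le> k then q ^ (k - i) else 0) =
     (\<Prod>i<r. (1 - q ^ (Suc k + i)) / (1 - q ^ Suc i))"
    (is "z_eval _ ?x = _")
proof -
  have "z_eval (h r) ?x = (\<Sum>m\<in>monomials r (Suc k). to_fract [:h r m:] * monomial_eval ?x m)"
  proof (rule z_eval_eq_sum[OF finite_monomials])
    fix m assume "m \<notin> monomials r (Suc k)"
    \<comment> \<open>Either the coefficient of \<open>h r\<close> vanishes, or \<open>m\<close>
      contains a variable that is set to 0.\<close>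
    then consider "mdeg m \<noteq> r" | i where "i \<in> Poly_Mapping.keys m" "i > k"
      by (auto simp: monomials_def) (meson not_less_eq)
    thus "to_fract [:h r m:] * monomial_eval ?x m = 0"
    proof cases
      case 1
      thus ?thesis by (simp add: h_eq)
    next
      case 2
      hence "monomial_eval ?x m = 0"
        unfolding monomial_eval_def
        by (intro prod_zero) (auto intro!: bexI[of _ i] simp: in_keys_iff)
      thus ?thesis by simp
    qed
  qed
  also have "\<dots> = (\<Sum>m\<in>monomials r (Suc k). monomial_eval ?x m)"
    by (intro sum.cong) (auto simp: monomials_def h_eq simp flip: one_pCons)
  also have "\<dots> = (\<Prod>i<r. (1 - q ^ (Suc k + i)) / (1 - q ^ Suc i))"
    \<comment> \<open>With all k+1 variables in use, the power of q in front has exponent 0.\<close>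
    by (subst sum_monomials_q_powers[of "Suc k" k]) simp_all
  finally show ?thesis .
qed

section \<open>Diagonal action of the operators and the conclusion\<close>

lemma Q_op_nth:
  "fps_nth (Q_op r F) k = (\<Prod>i<r. (1 - q ^ (Suc k + i)) / (1 - q ^ Suc i)) * fps_nth F k"
  \<comment> \<open>\<open>Theta\<close> scales the coefficient of t^k by q^k, so
    \<open>Q_factor (Suc i)\<close> scales it by the factor at index i, as k + (i+1) =
    \<open>Suc k + i\<close>.\<close>
  by (induction r)
     (simp_all add: Q_factor_def Theta_nth power_add divide_inverse algebra_simps)

lemma Q_op_commute: "Q_op r \<circ> Q_op s = Q_op s \<circ> Q_op r"
  by (auto simp: fun_eq_iff fps_eq_iff Q_op_nth)

lemma Psi_h_times:
  assumes f: "f \<in> QSym_hom N"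
  shows "Psi (N + r) (h r \<star> f) = Q_op r (Psi N f)"
proof (rule fps_ext)
  fix k
  let ?x = "\<lambda>i. if i \<le> k then q ^ (k - i) else 0"
  have "finite {i. ?x i \<noteq> 0}"
    by (rule finite_subset[of _ "{..k}"]) auto
  hence "z_eval (h r \<star> f) ?x = z_eval (h r) ?x * z_eval f ?x"
    using f h_in_QSym_hom[of r] by (intro z_eval_z_times) (simp_all add: QSym_hom_def)
  \<comment> \<open>\<open>Psi\<close> is restricted to \<open>QSym_hom\<close> and
    \<open>undefined\<close> elsewhere, so unfolding it on both sides takes membership of
    \<open>f\<close> and of \<open>h r \<star> f\<close>.\<close>
  thus "fps_nth (Psi (N + r) (h r \<star> f)) k = fps_nth (Q_op r (Psi N f)) k"
    using f h_times_in_QSym_hom[OF f, of r]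
    by (simp add: Psi_def Q_op_nth z_eval_h_q_powers)
qed

theorem theorem22:
  shows "(\<forall>N r. \<forall>f\<in>QSym_hom N. Psi (N + r) (h r \<star> f) = Q_op r (Psi N f)) \<and>
         (\<forall>r s. Q_op r \<circ> Q_op s = Q_op s \<circ> Q_op r)"
  using Psi_h_times Q_op_commute by blast

end
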